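(* Let $H$ be a separable Hilbert space, and let $X_1,\ldots,X_n$ be i.i.d. integrable $H$-valued random variables with common law $\mu$. Let $\mu^-$ be the law of $-X$, where $X$ has law $\mu$. Let $\varepsilon_1,\ldots,\varepsilon_n$ be i.i.d. Rademacher random variables, also independent of $X_1,\ldots,X_n$. Then, for any $1$-Lipschitz function $\psi:H\to\mathbb{R}$, $$ \mathbb{E}\,\psi\left(\sum_{i=1}^n (X_i-\mathbb{E}X_i)\right)\le \mathbb{E}\,\psi\left(\sum_{i=1}^n \varepsilon_i(X_i-\mathbb{E}X_i)\right)+\sqrt{\frac{n}{2}}\,W_2(\mu,\mu^-). $$
   Context: A Rademacher random variable $\varepsilon$ satisfies $\mathbb{P}(\varepsilon=1)=\mathbb{P}(\varepsilon=-1)=1/2$. For a Polish space $(\mathcal{X},d)$, $p\in[1,\infty)$ and probability measures $\mu,\nu$ on $\mathcal{X}$, the Wasserstein $p$ distance is $$W_p(\mu,\nu)=\inf_{\gamma\in\Pi(\mu,\nu)}\left(\int_{\mathcal{X}\times\mathcal{X}}d(x,y)^p\,d\gamma(x,y)\right)^{1/p},$$ where $\Pi(\mu,\nu)$ is the set of probability measures on $\mathcal{X}\times\mathcal{X}$ with marginals $\mu$ and $\nu$. Here $\mathcal{X}=H$ and $d$ is the metric given by the norm of $H$; $1$-Lipschitz is with respect to this metric. *)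

theory Defs
  imports "HOL-Probability.Probability"
begin

definition couplings ::
  "'a::{complete_space, second_countable_topology} measure \<Rightarrow> 'a measure \<Rightarrow> ('a \<times> 'a) measure set"
  where "couplings \<mu> \<nu> =
    {\<gamma>. sets \<gamma> = sets (borel \<Otimes>\<^sub>M borel) \<and> prob_space \<gamma> \<and>
         distr \<gamma> borel fst = \<mu> \<and> distr \<gamma> borel snd = \<nu>}"

(* x to the power 1/p in [0, \<infinity>] *)
definition ennreal_root :: "real \<Rightarrow> ennreal \<Rightarrow> ennreal"
  where "ennreal_root p x = (if x = \<top> then \<top> else ennreal (enn2real x powr (1 / p)))"

(* No moment condition is imposed on the measures, so the value may be \<infinity>. *)
definition wasserstein ::
  "real \<Rightarrow> 'a::{complete_space, second_countable_topology} measure \<Rightarrow> 'a measure \<Rightarrow> ennreal"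
  where "wasserstein p \<mu> \<nu> =
    (INF \<gamma>\<in>couplings \<mu> \<nu>. ennreal_root p (\<integral>\<^sup>+ (x, y). ennreal (dist x y powr p) \<partial>\<gamma>))"

definition rademacher :: "'w measure \<Rightarrow> ('w \<Rightarrow> real) \<Rightarrow> bool"
  where "rademacher M \<epsilon> \<longleftrightarrow>
    \<epsilon> \<in> borel_measurable M \<and>
    measure M {\<omega> \<in> space M. \<epsilon> \<omega> = 1} = 1 / 2 \<and>
    measure M {\<omega> \<in> space M. \<epsilon> \<omega> = - 1} = 1 / 2"

(* The library's indep_var forces both variables to have the same value type;
   this is the same notion for two different value types. *)
definition indep_pair ::
  "'w measure \<Rightarrow> 'a measure \<Rightarrow> ('w \<Rightarrow> 'a) \<Rightarrow> 'b measure \<Rightarrow> ('w \<Rightarrow> 'b) \<Rightarrow> bool"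
  where "indep_pair M N Y K Z \<longleftrightarrow>
    Y \<in> measurable M N \<and> Z \<in> measurable M K \<and>
    prob_space.indep_set M
      {Y -` A \<inter> space M | A. A \<in> sets N} {Z -` B \<inter> space M | B. B \<in> sets K}"

end

theory Submission
  imports Defs
begin

text \<open>
  Condition on the set \<open>J\<close> of indices with \<open>\<epsilon>\<^sub>i = -1\<close>. Flipping the signs in \<open>J\<close> replaces the law
  \<open>\<mu>\<close> of \<open>X\<^sub>i\<close> by \<open>\<mu>\<^sup>-\<close> for \<open>i \<in> J\<close>, so both sums can be realised on independent copies of a coupling
  \<open>\<gamma>\<close> of \<open>\<mu>\<close> and \<open>\<mu>\<^sup>-\<close>, where they differ by \<open>card J\<close> independent centered summands. By orthogonality
  the \<open>L\<^sup>1\<close> distance of the sums is at most \<open>sqrt (card J)\<close> times the \<open>L\<^sup>2\<close> cost of \<open>\<gamma>\<close>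
  (centering only decreases it). Averaging over \<open>J\<close>, whose mean size is \<open>n / 2\<close>, gives the factor
  \<open>sqrt (n / 2)\<close> by concavity of the square root.
\<close>

section \<open>Orthogonality of independent centered vectors\<close>

text \<open>Cauchy-Schwarz dominates the inner product by a product of independent integrable norms.
  The expectation then factors by Fubini on the product of the two laws, the integral passing
  through the inner product one argument at a time.\<close>

lemma (in prob_space)
  fixes X Y :: "'a \<Rightarrow> 'h::{real_inner, banach, second_countable_topology}"
  assumes indep: "indep_var borel X borel Y" and X: "integrable M X" and Y: "integrable M Y"
  shows indep_var_integrable_inner: "integrable M (\<lambda>\<omega>. X \<omega> \<bullet> Y \<omega>)"
    and indep_var_expectation_inner: "expectation (\<lambda>\<omega>. X \<omega> \<bullet> Y \<omega>) = expectation X \<bullet> expectation Y"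
proof -
  note [measurable] = borel_measurable_integrable[OF X] borel_measurable_integrable[OF Y]
  have "indep_var borel (norm \<circ> X) borel (norm \<circ> Y)"
    by (rule indep_var_compose[OF indep]) auto
  then have "integrable M (\<lambda>\<omega>. norm (X \<omega>) * norm (Y \<omega>))"
    using indep_var_integrable[of "norm \<circ> X" "norm \<circ> Y"] X Y by (simp add: comp_def)
  then show int: "integrable M (\<lambda>\<omega>. X \<omega> \<bullet> Y \<omega>)"
    by (rule Bochner_Integration.integrable_bound) (auto intro: Cauchy_Schwarz_ineq2)
  interpret DX: prob_space "distr M borel X" by (rule prob_space_distr) simp
  interpret DY: prob_space "distr M borel Y" by (rule prob_space_distr) simp
  interpret D: pair_prob_space "distr M borel X" "distr M borel Y" ..
  have joint: "distr M borel X \<Otimes>\<^sub>M distr M borel Y = distr M (borel \<Otimes>\<^sub>M borel) (\<lambda>\<omega>. (X \<omega>, Y \<omega>))"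
    using indep by (simp add: indep_var_distribution_eq)
  have meas: "(\<lambda>(x, y). x \<bullet> y) \<in> borel_measurable (borel \<Otimes>\<^sub>M (borel :: 'h measure))"
    by measurable
  have "integrable (distr M borel X \<Otimes>\<^sub>M distr M borel Y) (\<lambda>(x, y). x \<bullet> y)"
    unfolding joint using int by (subst integrable_distr_eq[OF _ meas]) simp_all
  from D.integral_fst'[OF this]
  have "(\<integral>x. \<integral>y. x \<bullet> y \<partial>distr M borel Y \<partial>distr M borel X)
      = integral\<^sup>L (distr M (borel \<Otimes>\<^sub>M borel) (\<lambda>\<omega>. (X \<omega>, Y \<omega>))) (\<lambda>(x, y). x \<bullet> y)"
    by (simp add: joint)
  also have "\<dots> = expectation (\<lambda>\<omega>. X \<omega> \<bullet> Y \<omega>)"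
    by (subst integral_distr[OF _ meas]) simp_all
  finally show "expectation (\<lambda>\<omega>. X \<omega> \<bullet> Y \<omega>) = expectation X \<bullet> expectation Y"
    using X Y by (simp add: integral_distr)
qed

lemma (in prob_space) indep_vars_pairwise:
  assumes indep: "indep_vars (\<lambda>_. N) X I" and "i \<in> I" "j \<in> I" "i \<noteq> j"
  shows "indep_var N (X i) N (X j)"
proof -
  have "indep_var N ((\<lambda>f. f i) \<circ> (\<lambda>\<omega>. restrict (\<lambda>i. X i \<omega>) {i}))
                  N ((\<lambda>f. f j) \<circ> (\<lambda>\<omega>. restrict (\<lambda>i. X i \<omega>) {j}))"
    using assms by (intro indep_var_compose[OF indep_var_restrict[OF indep]]) auto
  then show ?thesis by (simp add: comp_def)
qed

text \<open>Pythagoras: when the squared norm is expanded, every off-diagonal term has expectation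
  equal to the inner product of two zero means.\<close>

lemma (in prob_space)
  fixes Z :: "'i \<Rightarrow> 'a \<Rightarrow> 'h::{real_inner, banach, second_countable_topology}"
  assumes fin: "finite I" and indep: "indep_vars (\<lambda>_. borel) Z I"
    and int: "\<And>i. i \<in> I \<Longrightarrow> integrable M (Z i)"
    and zero: "\<And>i. i \<in> I \<Longrightarrow> expectation (Z i) = 0"
    and sq: "\<And>i. i \<in> I \<Longrightarrow> integrable M (\<lambda>\<omega>. (norm (Z i \<omega>))\<^sup>2)"
  shows integrable_norm_sum_indep: "integrable M (\<lambda>\<omega>. (norm (\<Sum>i\<in>I. Z i \<omega>))\<^sup>2)"
    and expectation_norm_sum_indep:
      "expectation (\<lambda>\<omega>. (norm (\<Sum>i\<in>I. Z i \<omega>))\<^sup>2) = (\<Sum>i\<in>I. expectation (\<lambda>\<omega>. (norm (Z i \<omega>))\<^sup>2))"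
proof -
  have expand: "(\<lambda>\<omega>. (norm (\<Sum>i\<in>I. Z i \<omega>))\<^sup>2) = (\<lambda>\<omega>. \<Sum>i\<in>I. \<Sum>j\<in>I. Z i \<omega> \<bullet> Z j \<omega>)"
    by (subst sum.swap) (simp add: power2_norm_eq_inner inner_sum_left inner_sum_right)
  have cross: "integrable M (\<lambda>\<omega>. Z i \<omega> \<bullet> Z j \<omega>) \<and>
      expectation (\<lambda>\<omega>. Z i \<omega> \<bullet> Z j \<omega>) = (if i = j then expectation (\<lambda>\<omega>. (norm (Z i \<omega>))\<^sup>2) else 0)"
    if "i \<in> I" "j \<in> I" for i j
  proof (cases "i = j")
    case True
    then show ?thesis using sq that by (simp add: power2_norm_eq_inner)
  next
    case False
    note indep_vars_pairwise[OF indep that False]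
    then show ?thesis
      using indep_var_integrable_inner[of "Z i" "Z j"] indep_var_expectation_inner[of "Z i" "Z j"]
        int zero that False by auto
  qed
  show "integrable M (\<lambda>\<omega>. (norm (\<Sum>i\<in>I. Z i \<omega>))\<^sup>2)"
    unfolding expand using cross by (intro Bochner_Integration.integrable_sum) auto
  show "expectation (\<lambda>\<omega>. (norm (\<Sum>i\<in>I. Z i \<omega>))\<^sup>2) = (\<Sum>i\<in>I. expectation (\<lambda>\<omega>. (norm (Z i \<omega>))\<^sup>2))"
    unfolding expand using cross fin
    by (simp add: Bochner_Integration.integral_sum)
qed

text \<open>The variance of the norm of the sum is nonnegative, so its mean is at most the root of
  its second moment, which orthogonality evaluates.\<close>

lemma (in prob_space) expectation_norm_sum_indep_le:
  fixes Z :: "'i \<Rightarrow> 'a \<Rightarrow> 'h::{real_inner, banach, second_countable_topology}"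
  assumes fin: "finite I" and indep: "indep_vars (\<lambda>_. borel) Z I"
    and int: "\<And>i. i \<in> I \<Longrightarrow> integrable M (Z i)"
    and zero: "\<And>i. i \<in> I \<Longrightarrow> expectation (Z i) = 0"
    and sq: "\<And>i. i \<in> I \<Longrightarrow> integrable M (\<lambda>\<omega>. (norm (Z i \<omega>))\<^sup>2)"
  shows "expectation (\<lambda>\<omega>. norm (\<Sum>i\<in>I. Z i \<omega>)) \<le> sqrt (\<Sum>i\<in>I. expectation (\<lambda>\<omega>. (norm (Z i \<omega>))\<^sup>2))"
proof -
  let ?S = "\<lambda>\<omega>. norm (\<Sum>i\<in>I. Z i \<omega>)"
  have "integrable M ?S" using int by auto
  then have "0 \<le> expectation (\<lambda>\<omega>. (?S \<omega>)\<^sup>2) - (expectation ?S)\<^sup>2"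
    using variance_eq[of ?S] variance_positive[of ?S] integrable_norm_sum_indep[OF assms] by simp
  then show ?thesis
    by (intro real_le_rsqrt) (simp add: expectation_norm_sum_indep[OF assms])
qed

text \<open>Expanding around the mean \<open>?c\<close> shows that centering lowers the second
  moment by exactly the squared norm of \<open>?c\<close>. This is what lets centered differences be
  charged to the uncentered transport cost.\<close>

lemma (in prob_space)
  fixes Z :: "'a \<Rightarrow> 'h::{real_inner, banach, second_countable_topology}"
  assumes int: "integrable M Z" and sq: "integrable M (\<lambda>\<omega>. (norm (Z \<omega>))\<^sup>2)"
  shows integrable_norm_centered: "integrable M (\<lambda>\<omega>. (norm (Z \<omega> - expectation Z))\<^sup>2)"
    and expectation_norm_centered_le:
      "expectation (\<lambda>\<omega>. (norm (Z \<omega> - expectation Z))\<^sup>2) \<le> expectation (\<lambda>\<omega>. (norm (Z \<omega>))\<^sup>2)"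
proof -
  let ?c = "expectation Z"
  have expand: "(\<lambda>\<omega>. (norm (Z \<omega> - ?c))\<^sup>2) = (\<lambda>\<omega>. (norm (Z \<omega>))\<^sup>2 - 2 * (Z \<omega> \<bullet> ?c) + (norm ?c)\<^sup>2)"
    by (auto simp: power2_norm_eq_inner inner_diff_left inner_diff_right inner_commute)
  show "integrable M (\<lambda>\<omega>. (norm (Z \<omega> - ?c))\<^sup>2)"
    unfolding expand using int sq by auto
  have "expectation (\<lambda>\<omega>. (norm (Z \<omega> - ?c))\<^sup>2) = expectation (\<lambda>\<omega>. (norm (Z \<omega>))\<^sup>2) - (norm ?c)\<^sup>2"
    unfolding expand using int sq by (simp add: prob_space power2_norm_eq_inner)
  then show "expectation (\<lambda>\<omega>. (norm (Z \<omega> - ?c))\<^sup>2) \<le> expectation (\<lambda>\<omega>. (norm (Z \<omega>))\<^sup>2)"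
    by simp
qed

section \<open>Sums of independent variables and product spaces\<close>

text \<open>Under independence the joint law is the product of the marginals, so the law of the sum
  depends on the marginals alone. It serves to move a sum to another probability space.\<close>

lemma distr_sum_indep_eq:
  fixes X :: "'i \<Rightarrow> 'a \<Rightarrow> 'h::{real_normed_vector, second_countable_topology}"
  assumes M: "prob_space M" and N: "prob_space N"
    and X: "prob_space.indep_vars M (\<lambda>_. borel) X I"
    and Y: "prob_space.indep_vars N (\<lambda>_. borel) Y I"
    and eq: "\<And>i. i \<in> I \<Longrightarrow> distr M borel (X i) = distr N borel (Y i)"
    and "finite I" "I \<noteq> {}"
  shows "distr M borel (\<lambda>\<omega>. \<Sum>i\<in>I. X i \<omega>) = distr N borel (\<lambda>\<omega>. \<Sum>i\<in>I. Y i \<omega>)"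
proof -
  have sum: "distr K borel (\<lambda>\<omega>. \<Sum>i\<in>I. Z i \<omega>)
      = distr (\<Pi>\<^sub>M i\<in>I. distr K borel (Z i)) borel (\<lambda>x. \<Sum>i\<in>I. x i)"
    if K: "prob_space K" and Z: "prob_space.indep_vars K (\<lambda>_. borel) Z I"
    for K :: "'k measure" and Z :: "'i \<Rightarrow> 'k \<Rightarrow> 'h"
  proof -
    interpret K: prob_space K by fact
    have [measurable]: "Z i \<in> borel_measurable K" if "i \<in> I" for i
      using Z that by (simp add: K.indep_vars_def)
    have "distr K borel (\<lambda>\<omega>. \<Sum>i\<in>I. Z i \<omega>)
        = distr (distr K (\<Pi>\<^sub>M i\<in>I. borel) (\<lambda>\<omega>. \<lambda>i\<in>I. Z i \<omega>)) borel (\<lambda>x. \<Sum>i\<in>I. x i)"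
      by (subst distr_distr) (auto simp: comp_def intro!: distr_cong)
    then show ?thesis
      using K.indep_vars_iff_distr_eq_PiM'[where M'="\<lambda>_. borel" and X=Z, OF \<open>I \<noteq> {}\<close>] Z
      by simp
  qed
  show ?thesis
    unfolding sum[OF M X] sum[OF N Y] by (intro distr_cong PiM_cong) (auto simp: eq)
qed

lemma indep_vars_PiM_component:
  assumes "\<And>i. i \<in> I \<Longrightarrow> prob_space (N i)"
  shows "prob_space.indep_vars (\<Pi>\<^sub>M i\<in>I. N i) N (\<lambda>i x. x i) I"
proof -
  interpret P: prob_space "\<Pi>\<^sub>M i\<in>I. N i" by (rule prob_space_PiM) (rule assms)
  show ?thesis
  \<comment> \<open>The characterisation of independence by a product law requires a nonempty index
    set.\<close>
  proof (cases "I = {}")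
    case True
    show ?thesis unfolding P.indep_vars_def P.indep_sets_def by (simp add: True)
  next
    case False
    \<comment> \<open>The joint law of the coordinates is the image under restriction to
      \<open>I\<close>, which fixes every point of the product space. It is therefore the product
      measure itself.\<close>
    have "distr (\<Pi>\<^sub>M i\<in>I. N i) (\<Pi>\<^sub>M i\<in>I. N i) (\<lambda>x. \<lambda>i\<in>I. x i)
        = distr (\<Pi>\<^sub>M i\<in>I. N i) (\<Pi>\<^sub>M i\<in>I. N i) (\<lambda>x. x)"
      by (intro distr_cong) (auto simp: space_PiM)
    also have "\<dots> = (\<Pi>\<^sub>M i\<in>I. N i)"
      by (rule distr_id)
    also have "\<dots> = (\<Pi>\<^sub>M i\<in>I. distr (\<Pi>\<^sub>M i\<in>I. N i) (N i) (\<lambda>x. x i))"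
      by (intro PiM_cong distr_PiM_component[symmetric] assms) auto
    finally show ?thesis
      by (subst P.indep_vars_iff_distr_eq_PiM'[OF False]) auto
  qed
qed

section \<open>Lipschitz functions of two coupled sums\<close>

text \<open>A Lipschitz function grows at most linearly, so an affine function of
  \<open>norm (Y \<omega>)\<close> dominates it.\<close>

lemma (in prob_space) integrable_lipschitz:
  fixes Y :: "'a \<Rightarrow> 'h::{banach, second_countable_topology}" and \<psi> :: "'h \<Rightarrow> real"
  assumes lip: "L-lipschitz_on UNIV \<psi>" and Y: "integrable M Y"
  shows "integrable M (\<lambda>\<omega>. \<psi> (Y \<omega>))"
proof -
  have [measurable]: "\<psi> \<in> borel_measurable borel"
    using lipschitz_on_continuous_on[OF lip] by (rule borel_measurable_continuous_onI)
  note [measurable] = borel_measurable_integrable[OF Y]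
  have bound: "norm (\<psi> y) \<le> norm (\<bar>\<psi> 0\<bar> + L * norm y)" for y
    using lipschitz_onD[OF lip, of y 0] by (simp add: dist_real_def dist_norm)
  show ?thesis
    by (rule Bochner_Integration.integrable_bound[where f="\<lambda>\<omega>. \<bar>\<psi> 0\<bar> + L * norm (Y \<omega>)"])
      (use Y bound in auto)
qed

lemma distr_eq_imp_distr_comp_eq:
  assumes "distr M K X = distr N K Y" "X \<in> measurable M K" "Y \<in> measurable N K" "f \<in> measurable K L"
  shows "distr M L (\<lambda>\<omega>. f (X \<omega>)) = distr N L (\<lambda>\<omega>. f (Y \<omega>))"
  using assms distr_distr[of f K L X M] distr_distr[of f K L Y N] by (simp add: comp_def)

text \<open>Each integral depends only on the law of its sum, so both sums can be rebuilt from the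
  same independent copies of the pair \<open>(U, V)\<close>. The rebuilt sums agree outside
  \<open>J\<close>; inside \<open>J\<close> they differ by independent centered copies of
  \<open>U - V\<close>, to which orthogonality applies.\<close>

lemma lipschitz_sum_coupling:
  fixes A B :: "'i \<Rightarrow> 'a \<Rightarrow> 'h::{real_inner, banach, second_countable_topology}"
    and U V :: "'b \<Rightarrow> 'h" and \<psi> :: "'h \<Rightarrow> real"
  assumes M: "prob_space M" and \<gamma>: "prob_space \<gamma>" and I: "finite I" "J \<subseteq> I"
    and A: "prob_space.indep_vars M (\<lambda>_. borel) A I"
    and B: "prob_space.indep_vars M (\<lambda>_. borel) B I"
    and U: "integrable \<gamma> U" and V: "integrable \<gamma> V"
    and mean: "(\<integral>z. U z - V z \<partial>\<gamma>) = 0"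
    and sq: "integrable \<gamma> (\<lambda>z. (norm (U z - V z))\<^sup>2)"
    and A_law: "\<And>i. i \<in> I \<Longrightarrow> distr M borel (A i) = distr \<gamma> borel U"
    and B_law: "\<And>i. i \<in> I \<Longrightarrow> distr M borel (B i) = distr \<gamma> borel (if i \<in> J then V else U)"
    and \<psi>: "1-lipschitz_on UNIV \<psi>"
  shows "(\<integral>\<omega>. \<psi> (\<Sum>i\<in>I. A i \<omega>) \<partial>M)
    \<le> (\<integral>\<omega>. \<psi> (\<Sum>i\<in>I. B i \<omega>) \<partial>M) + sqrt (card J * (\<integral>z. (norm (U z - V z))\<^sup>2 \<partial>\<gamma>))"
proof (cases "I = {}")
  case True
  then show ?thesis by simp
next
  case False
  interpret M: prob_space M by fact
  interpret \<gamma>: prob_space \<gamma> by fact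
  \<comment> \<open>The coordinates of a point of \<open>P\<close> are independent points of law
    \<open>\<gamma>\<close>, each carrying one coupled pair \<open>(U, V)\<close>.\<close>
  define P where "P = (\<Pi>\<^sub>M i\<in>I. \<gamma>)"
  interpret P: prob_space P unfolding P_def by (rule prob_space_PiM) (rule \<gamma>)
  note [measurable] = borel_measurable_integrable[OF U] borel_measurable_integrable[OF V]
  have [measurable]: "\<psi> \<in> borel_measurable borel"
    using lipschitz_on_continuous_on[OF \<psi>] by (rule borel_measurable_continuous_onI)
  have comp: "P.indep_vars (\<lambda>_. \<gamma>) (\<lambda>i x. x i) I"
    unfolding P_def by (rule indep_vars_PiM_component) (rule \<gamma>)
  have meas_comp: "(\<lambda>x. x i) \<in> measurable P \<gamma>" if "i \<in> I" for i
    using that by (simp add: P_def)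
  have law: "distr P \<gamma> (\<lambda>x. x i) = \<gamma>" if "i \<in> I" for i
    unfolding P_def using that I \<gamma> by (intro distr_PiM_component) auto
  have law_comp: "distr P borel (\<lambda>x. f (x i)) = distr \<gamma> borel f"
    if "i \<in> I" "f \<in> borel_measurable \<gamma>" for i and f :: "'b \<Rightarrow> 'h"
    using distr_distr[OF that(2) meas_comp[OF that(1)]] law[OF that(1)] by (simp add: comp_def)
  have int_comp: "integrable P (\<lambda>x. f (x i))" "(\<integral>x. f (x i) \<partial>P) = (\<integral>z. f z \<partial>\<gamma>)"
    if "i \<in> I" "integrable \<gamma> f" for i and f :: "'b \<Rightarrow> 'c::{banach, second_countable_topology}"
    using that integrable_distr_eq[OF meas_comp, of i f] integral_distr[OF meas_comp, of i f] law[of i]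
    by auto
  \<comment> \<open>\<open>W i\<close> is chosen so that \<open>W i (x i)\<close> has the law of
    \<open>B i\<close>.\<close>
  define W where "W i = (if i \<in> J then V else U)" for i
  have W: "integrable \<gamma> (W i)" for i using U V by (simp add: W_def)
  note [measurable] = borel_measurable_integrable[OF W]
  have indepU: "P.indep_vars (\<lambda>_. borel) (\<lambda>i x. U (x i)) I"
    by (rule P.indep_vars_compose2[OF comp]) simp
  have indepW: "P.indep_vars (\<lambda>_. borel) (\<lambda>i x. W i (x i)) I"
    by (rule P.indep_vars_compose2[OF comp]) simp
  have indepZ: "P.indep_vars (\<lambda>_. borel) (\<lambda>i x. U (x i) - V (x i)) J"
    using P.indep_vars_subset[OF comp \<open>J \<subseteq> I\<close>] by (rule P.indep_vars_compose2) simp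
  have [measurable]: "A i \<in> borel_measurable M" "B i \<in> borel_measurable M" if "i \<in> I" for i
    using A B that by (auto simp: M.indep_vars_def)
  have [measurable]: "(\<lambda>x. U (x i)) \<in> borel_measurable P" "(\<lambda>x. W i (x i)) \<in> borel_measurable P" if "i \<in> I" for i
    by (auto intro: measurable_compose[OF meas_comp[OF that]])
  \<comment> \<open>The joint behaviour of \<open>A\<close> and \<open>B\<close> on \<open>M\<close>
    is arbitrary; each sum is transferred to \<open>P\<close> separately, through its law.\<close>
  have "distr M borel (\<lambda>\<omega>. \<Sum>i\<in>I. A i \<omega>) = distr P borel (\<lambda>x. \<Sum>i\<in>I. U (x i))"
    by (rule distr_sum_indep_eq[OF M P.prob_space_axioms A indepU _ I(1) False]) (simp add: A_law law_comp)
  from arg_cong[OF this, of "\<lambda>D. integral\<^sup>L D \<psi>"]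
  have A_eq: "(\<integral>\<omega>. \<psi> (\<Sum>i\<in>I. A i \<omega>) \<partial>M) = (\<integral>x. \<psi> (\<Sum>i\<in>I. U (x i)) \<partial>P)"
    by (simp add: integral_distr)
  have "distr M borel (\<lambda>\<omega>. \<Sum>i\<in>I. B i \<omega>) = distr P borel (\<lambda>x. \<Sum>i\<in>I. W i (x i))"
    by (rule distr_sum_indep_eq[OF M P.prob_space_axioms B indepW _ I(1) False])
      (simp add: B_law law_comp W_def)
  from arg_cong[OF this, of "\<lambda>D. integral\<^sup>L D \<psi>"]
  have B_eq: "(\<integral>\<omega>. \<psi> (\<Sum>i\<in>I. B i \<omega>) \<partial>M) = (\<integral>x. \<psi> (\<Sum>i\<in>I. W i (x i)) \<partial>P)"
    by (simp add: integral_distr)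
  have diff: "(\<Sum>i\<in>I. U (x i)) - (\<Sum>i\<in>I. W i (x i)) = (\<Sum>i\<in>J. U (x i) - V (x i))" for x
  proof -
    have "(\<Sum>i\<in>J. U (x i) - V (x i)) = (\<Sum>i\<in>J. U (x i) - W i (x i))"
      by (simp add: W_def)
    also have "\<dots> = (\<Sum>i\<in>I. U (x i) - W i (x i))"
      using I by (intro sum.mono_neutral_left) (auto simp: W_def)
    finally show ?thesis by (simp add: sum_subtractf)
  qed
  have intU: "integrable P (\<lambda>x. \<Sum>i\<in>I. U (x i))" and intW: "integrable P (\<lambda>x. \<Sum>i\<in>I. W i (x i))"
    using int_comp(1)[OF _ U] int_comp(1)[OF _ W] by auto
  have UV: "integrable \<gamma> (\<lambda>z. U z - V z)" using U V by simp
  have intZ: "integrable P (\<lambda>x. U (x i) - V (x i))" if "i \<in> J" for i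
    using int_comp(1)[OF _ UV] I that by auto
  \<comment> \<open>On \<open>P\<close> the Lipschitz bound holds pointwise; integrating it leaves
    the mean norm of the sum over \<open>J\<close>.\<close>
  have "(\<integral>x. \<psi> (\<Sum>i\<in>I. U (x i)) \<partial>P)
      \<le> (\<integral>x. \<psi> (\<Sum>i\<in>I. W i (x i)) + norm (\<Sum>i\<in>J. U (x i) - V (x i)) \<partial>P)"
  proof (rule integral_mono)
    show "integrable P (\<lambda>x. \<psi> (\<Sum>i\<in>I. U (x i)))"
      by (rule P.integrable_lipschitz[OF \<psi> intU])
    show "integrable P (\<lambda>x. \<psi> (\<Sum>i\<in>I. W i (x i)) + norm (\<Sum>i\<in>J. U (x i) - V (x i)))"
      using P.integrable_lipschitz[OF \<psi> intW] intZ
      by (intro Bochner_Integration.integrable_add integrable_norm Bochner_Integration.integrable_sum) auto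
    show "\<psi> (\<Sum>i\<in>I. U (x i)) \<le> \<psi> (\<Sum>i\<in>I. W i (x i)) + norm (\<Sum>i\<in>J. U (x i) - V (x i))" for x
      using lipschitz_onD[OF \<psi>, of "\<Sum>i\<in>I. U (x i)" "\<Sum>i\<in>I. W i (x i)"]
      by (simp add: dist_real_def dist_norm diff)
  qed
  also have "\<dots> = (\<integral>x. \<psi> (\<Sum>i\<in>I. W i (x i)) \<partial>P) + (\<integral>x. norm (\<Sum>i\<in>J. U (x i) - V (x i)) \<partial>P)"
    using P.integrable_lipschitz[OF \<psi> intW] intZ
    by (intro Bochner_Integration.integral_add integrable_norm Bochner_Integration.integrable_sum) auto
  also have "(\<integral>x. norm (\<Sum>i\<in>J. U (x i) - V (x i)) \<partial>P)
      \<le> sqrt (\<Sum>i\<in>J. \<integral>x. (norm (U (x i) - V (x i)))\<^sup>2 \<partial>P)"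
  proof (rule P.expectation_norm_sum_indep_le[OF _ indepZ intZ])
    show "finite J" using I finite_subset by auto
    show "(\<integral>x. U (x i) - V (x i) \<partial>P) = 0" if "i \<in> J" for i
      using int_comp(2)[OF _ UV, of i] that I mean by auto
    show "integrable P (\<lambda>x. (norm (U (x i) - V (x i)))\<^sup>2)" if "i \<in> J" for i
      using int_comp(1)[OF _ sq, of i] that I by auto
  qed
  also have "(\<Sum>i\<in>J. \<integral>x. (norm (U (x i) - V (x i)))\<^sup>2 \<partial>P) = (\<Sum>i\<in>J. \<integral>z. (norm (U z - V z))\<^sup>2 \<partial>\<gamma>)"
    using I by (intro sum.cong int_comp(2)[OF _ sq]) auto
  finally show ?thesis by (simp add: A_eq B_eq)
qed

section \<open>Averaging over random signs\<close>

text \<open>Preimages under a composite are preimages under the inner map, so independence passes to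
  images. Mapping both variables into one value type makes \<open>indep_var\<close> and its product
  formulas available.\<close>

lemma (in prob_space) indep_pair_imp_indep_var:
  assumes indep: "indep_pair M N Y K Z" and f: "f \<in> measurable N L" and g: "g \<in> measurable K L'"
  shows "indep_var L (\<lambda>\<omega>. f (Y \<omega>)) L' (\<lambda>\<omega>. g (Z \<omega>))"
proof -
  have Y: "Y \<in> measurable M N" and Z: "Z \<in> measurable M K"
    and sets: "indep_set {Y -` A \<inter> space M |A. A \<in> sets N} {Z -` A \<inter> space M |A. A \<in> sets K}"
    using indep by (auto simp: indep_pair_def)
  have preim: "\<exists>A'. (\<lambda>\<omega>. h (W \<omega>)) -` A \<inter> space M = W -` A' \<inter> space M \<and> A' \<in> sets R"
    if "W \<in> measurable M R" "h \<in> measurable R T" "A \<in> sets T"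
    for W :: "'a \<Rightarrow> 'r" and R and h :: "'r \<Rightarrow> 't" and T A
  proof (intro exI conjI)
    show "h -` A \<inter> space R \<in> sets R" using that by (auto intro: measurable_sets)
    show "(\<lambda>\<omega>. h (W \<omega>)) -` A \<inter> space M = W -` (h -` A \<inter> space R) \<inter> space M"
      using measurable_space[OF that(1)] by auto
  qed
  \<comment> \<open>\<open>indep_var_eq\<close> speaks of generated sigma-algebras; independence
    extends to them from generators closed under intersection.\<close>
  have stable: "Int_stable {W -` A \<inter> space M |A. A \<in> sets T}" for W :: "'a \<Rightarrow> 't" and T
  proof (rule Int_stableI, safe)
    fix A B assume "A \<in> sets T" "B \<in> sets T"
    then show "\<exists>C. W -` A \<inter> space M \<inter> (W -` B \<inter> space M) = W -` C \<inter> space M \<and> C \<in> sets T"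
      by (intro exI[of _ "A \<inter> B"]) auto
  qed
  have "indep_set {(\<lambda>\<omega>. f (Y \<omega>)) -` A \<inter> space M |A. A \<in> sets L}
      {(\<lambda>\<omega>. g (Z \<omega>)) -` A \<inter> space M |A. A \<in> sets L'}"
  proof (rule indep_setI)
    show "{(\<lambda>\<omega>. f (Y \<omega>)) -` A \<inter> space M |A. A \<in> sets L} \<subseteq> events"
      using measurable_sets[OF measurable_compose[OF Y f]] by auto
    show "{(\<lambda>\<omega>. g (Z \<omega>)) -` A \<inter> space M |A. A \<in> sets L'} \<subseteq> events"
      using measurable_sets[OF measurable_compose[OF Z g]] by auto
    fix a b
    assume "a \<in> {(\<lambda>\<omega>. f (Y \<omega>)) -` A \<inter> space M |A. A \<in> sets L}"
      and "b \<in> {(\<lambda>\<omega>. g (Z \<omega>)) -` A \<inter> space M |A. A \<in> sets L'}"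
    then show "prob (a \<inter> b) = prob a * prob b"
      using preim[OF Y f] preim[OF Z g] by (intro indep_setD[OF sets]) blast+
  qed
  then show ?thesis
    unfolding indep_var_eq using measurable_compose[OF Y f] measurable_compose[OF Z g]
    by (auto intro!: indep_set_sigma_sets stable)
qed

text \<open>The two disjoint events of probability 1/2 exhaust the total mass.\<close>

lemma (in prob_space) rademacher_AE:
  assumes "rademacher M \<epsilon>"
  shows "AE \<omega> in M. \<epsilon> \<omega> = 1 \<or> \<epsilon> \<omega> = - 1"
proof -
  have [measurable]: "\<epsilon> \<in> borel_measurable M" using assms by (simp add: rademacher_def)
  have "prob {\<omega> \<in> space M. \<epsilon> \<omega> = 1 \<or> \<epsilon> \<omega> = - 1}
      = prob ({\<omega> \<in> space M. \<epsilon> \<omega> = 1} \<union> {\<omega> \<in> space M. \<epsilon> \<omega> = - 1})"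
    by (rule arg_cong[where f=prob]) auto
  also have "\<dots> = 1"
    using assms by (subst finite_measure_Union) (auto simp: rademacher_def)
  finally show ?thesis
    by (subst (asm) prob_Collect_eq_1) auto
qed

text \<open>Given the set \<open>J\<close> of negative signs, independence of the two tuples leaves
  the law of the \<open>X\<close> tuple unchanged. So the bounds for fixed \<open>J\<close> may be
  averaged, with the probabilities of the sign patterns as weights.\<close>

lemma (in prob_space) rademacher_average_le:
  fixes X :: "'i \<Rightarrow> 'a \<Rightarrow> 'h::{real_inner, banach, second_countable_topology}"
    and m :: "'i \<Rightarrow> 'h" and \<psi> :: "'h \<Rightarrow> real"
  assumes fin: "finite I"
    and indep: "indep_pair M (\<Pi>\<^sub>M i\<in>I. borel) (\<lambda>\<omega>. \<lambda>i\<in>I. X i \<omega>) (\<Pi>\<^sub>M i\<in>I. borel) (\<lambda>\<omega>. \<lambda>i\<in>I. \<epsilon> i \<omega>)"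
    and X: "\<And>i. i \<in> I \<Longrightarrow> integrable M (X i)"
    and \<epsilon>: "\<And>i. i \<in> I \<Longrightarrow> rademacher M (\<epsilon> i)"
    and \<psi>: "1-lipschitz_on UNIV \<psi>" and d: "0 \<le> d"
    and bound: "\<And>J. J \<subseteq> I \<Longrightarrow>
      a \<le> (\<integral>\<omega>. \<psi> (\<Sum>i\<in>I. (if i \<in> J then -1 else 1) *\<^sub>R (X i \<omega> - m i)) \<partial>M) + sqrt (card J) * d"
  shows "a \<le> (\<integral>\<omega>. \<psi> (\<Sum>i\<in>I. \<epsilon> i \<omega> *\<^sub>R (X i \<omega> - m i)) \<partial>M) + sqrt (card I / 2) * d"
\<comment> \<open>For empty \<open>I\<close> the number \<open>c\<close> below would be 0, and it is
  used as a divisor.\<close>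
proof (cases "I = {}")
  case True
  then show ?thesis using bound[of "{}"] by simp
next
  case False
  \<comment> \<open>\<open>N \<omega>\<close> is the random set of negative signs.
    \<open>S J\<close> and \<open>G J\<close> express \<open>F J\<close> and the indicator of
    \<open>E J\<close> as functions of the two tuples, the form in which \<open>indep_pair\<close>
    can be used.\<close>
  define S where "S J = (\<lambda>x. \<psi> (\<Sum>i\<in>I. (if i \<in> J then -1 else 1) *\<^sub>R (x i - m i)))" for J and x :: "'i \<Rightarrow> 'h"
  define F where "F J \<omega> = \<psi> (\<Sum>i\<in>I. (if i \<in> J then -1 else 1) *\<^sub>R (X i \<omega> - m i))" for J \<omega>
  define N where "N \<omega> = {i\<in>I. \<epsilon> i \<omega> = -1}" for \<omega>
  define E where "E J = {\<omega> \<in> space M. N \<omega> = J}" for J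
  define G :: "'i set \<Rightarrow> ('i \<Rightarrow> real) \<Rightarrow> real" where "G J x = (if \<forall>i\<in>I. (x i = -1) = (i \<in> J) then 1 else 0)" for J x
  have [measurable]: "\<psi> \<in> borel_measurable borel"
    using lipschitz_on_continuous_on[OF \<psi>] by (rule borel_measurable_continuous_onI)
  have \<epsilon>_meas [measurable]: "\<epsilon> i \<in> borel_measurable M" if "i \<in> I" for i
    using \<epsilon>[OF that] by (simp add: rademacher_def)
  have X_meas [measurable]: "X i \<in> borel_measurable M" if "i \<in> I" for i
    using X[OF that] by auto
  have [measurable]: "S J \<in> borel_measurable (\<Pi>\<^sub>M i\<in>I. borel)" for J
    unfolding S_def by measurable
  have [measurable]: "G J \<in> borel_measurable (\<Pi>\<^sub>M i\<in>I. borel)" for J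
    unfolding G_def using fin by measurable
  have N_eq: "N \<omega> = J \<longleftrightarrow> (\<forall>i\<in>I. (\<epsilon> i \<omega> = -1) = (i \<in> J))" if "J \<subseteq> I" for J \<omega>
    using that by (auto simp: N_def)
  have E_sets [measurable]: "E J \<in> events" if "J \<subseteq> I" for J
    unfolding E_def N_eq[OF that] using fin by measurable
  have F_int: "integrable M (F J)" for J
    unfolding F_def
    by (intro integrable_lipschitz[OF \<psi>] Bochner_Integration.integrable_sum integrable_scaleR_right
        Bochner_Integration.integrable_diff X) auto
  have E_int: "integrable M (indicat_real (E J))" if "J \<subseteq> I" for J
    using E_sets[OF that] by (simp add: integrable_indicator_iff emeasure_eq_measure)
  have prod: "integrable M (\<lambda>\<omega>. F J \<omega> * indicator (E J) \<omega>)"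
    "expectation (\<lambda>\<omega>. F J \<omega> * indicator (E J) \<omega>) = prob (E J) * expectation (F J)" if J: "J \<subseteq> I" for J
  proof -
    have "indep_var borel (\<lambda>\<omega>. S J (\<lambda>i\<in>I. X i \<omega>)) borel (\<lambda>\<omega>. G J (\<lambda>i\<in>I. \<epsilon> i \<omega>))"
      by (rule indep_pair_imp_indep_var[OF indep]) measurable
    moreover have "(\<lambda>\<omega>. S J (\<lambda>i\<in>I. X i \<omega>)) = F J"
      unfolding S_def F_def by (intro ext arg_cong[where f=\<psi>] sum.cong) auto
    ultimately have FG: "indep_var borel (F J) borel (\<lambda>\<omega>. G J (\<lambda>i\<in>I. \<epsilon> i \<omega>))" by simp
    have G: "G J (\<lambda>i\<in>I. \<epsilon> i \<omega>) = indicator (E J) \<omega>" if "\<omega> \<in> space M" for \<omega>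
      using that by (auto simp: G_def E_def N_eq[OF J])
    then have "integrable M (\<lambda>\<omega>. G J (\<lambda>i\<in>I. \<epsilon> i \<omega>))"
      using E_int[OF J] by (simp cong: Bochner_Integration.integrable_cong)
    from indep_var_integrable[OF FG F_int this] indep_var_lebesgue_integral[OF FG F_int this]
    show "integrable M (\<lambda>\<omega>. F J \<omega> * indicator (E J) \<omega>)"
      "expectation (\<lambda>\<omega>. F J \<omega> * indicator (E J) \<omega>) = prob (E J) * expectation (F J)"
      using G E_sets[OF J]
      by (simp_all cong: Bochner_Integration.integrable_cong Bochner_Integration.integral_cong)
  qed
  \<comment> \<open>The events \<open>E J\<close> with \<open>J \<subseteq> I\<close> partition the
    space, so only the term \<open>J = N \<omega>\<close> survives.\<close>
  have sum_ind: "(\<Sum>J\<in>Pow I. h J * indicator (E J) \<omega>) = h (N \<omega>)" if "\<omega> \<in> space M" for h :: "'i set \<Rightarrow> real" and \<omega>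
  proof -
    have "(\<Sum>J\<in>Pow I. h J * indicator (E J) \<omega>) = (\<Sum>J\<in>Pow I. if N \<omega> = J then h J else 0)"
      using that by (intro sum.cong) (auto simp: E_def)
    also have "\<dots> = h (N \<omega>)" using fin by (simp add: N_def)
    finally show ?thesis .
  qed
  have sum_prob: "(\<Sum>J\<in>Pow I. h J * prob (E J)) = expectation (\<lambda>\<omega>. h (N \<omega>))" for h :: "'i set \<Rightarrow> real"
  proof -
    have "expectation (\<lambda>\<omega>. h (N \<omega>)) = expectation (\<lambda>\<omega>. \<Sum>J\<in>Pow I. h J * indicator (E J) \<omega>)"
      by (intro Bochner_Integration.integral_cong) (simp_all add: sum_ind)
    also have "\<dots> = (\<Sum>J\<in>Pow I. expectation (\<lambda>\<omega>. h J * indicator (E J) \<omega>))"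
      using E_int by (intro Bochner_Integration.integral_sum) auto
    also have "\<dots> = (\<Sum>J\<in>Pow I. h J * prob (E J))"
      by (intro sum.cong) auto
    finally show ?thesis by simp
  qed
  have total: "(\<Sum>J\<in>Pow I. prob (E J)) = 1"
    using sum_prob[of "\<lambda>_. 1"] by (simp add: prob_space)
  \<comment> \<open>Linearity of expectation: the size of \<open>N \<omega>\<close> is a sum of
    indicators, each of mean 1/2.\<close>
  have mean_card: "(\<Sum>J\<in>Pow I. card J * prob (E J)) = card I / 2"
  proof -
    have "expectation (\<lambda>\<omega>. card (N \<omega>)) = expectation (\<lambda>\<omega>. \<Sum>i\<in>I. indicator {\<omega> \<in> space M. \<epsilon> i \<omega> = -1} \<omega>)"
    proof (intro Bochner_Integration.integral_cong refl)
      fix \<omega> assume "\<omega> \<in> space M"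
      then have "(\<Sum>i\<in>I. indicator {\<omega> \<in> space M. \<epsilon> i \<omega> = -1} \<omega>) = (\<Sum>i\<in>I. if \<epsilon> i \<omega> = -1 then 1 else (0::real))"
        by (intro sum.cong) auto
      also have "\<dots> = card (N \<omega>)"
        using fin by (simp add: N_def flip: sum.inter_filter)
      finally show "real (card (N \<omega>)) = (\<Sum>i\<in>I. indicator {\<omega> \<in> space M. \<epsilon> i \<omega> = -1} \<omega>)" ..
    qed
    also have "\<dots> = (\<Sum>i\<in>I. prob {\<omega> \<in> space M. \<epsilon> i \<omega> = -1})"
      by (subst Bochner_Integration.integral_sum)
        (auto simp: integrable_indicator_iff emeasure_eq_measure intro!: sum.cong arg_cong[where f=prob])
    also have "\<dots> = (\<Sum>i\<in>I. 1 / 2)"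
      using \<epsilon> by (intro sum.cong) (auto simp: rademacher_def)
    finally show ?thesis by (simp add: sum_prob)
  qed
  \<comment> \<open>Off a null set a sign different from -1 equals 1, so the signed sum is
    determined by \<open>N \<omega>\<close> and the \<open>X\<close> tuple.\<close>
  have "AE \<omega> in M. \<forall>i\<in>I. \<epsilon> i \<omega> = 1 \<or> \<epsilon> i \<omega> = -1"
    using fin \<epsilon> by (intro AE_finite_allI rademacher_AE) auto
  then have "AE \<omega> in M. \<psi> (\<Sum>i\<in>I. \<epsilon> i \<omega> *\<^sub>R (X i \<omega> - m i)) = (\<Sum>J\<in>Pow I. F J \<omega> * indicator (E J) \<omega>)"
    using AE_space
  proof eventually_elim
    fix \<omega> assume "\<omega> \<in> space M" "\<forall>i\<in>I. \<epsilon> i \<omega> = 1 \<or> \<epsilon> i \<omega> = -1"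
    then have "\<psi> (\<Sum>i\<in>I. \<epsilon> i \<omega> *\<^sub>R (X i \<omega> - m i)) = F (N \<omega>) \<omega>"
      unfolding F_def N_def by (intro arg_cong[where f=\<psi>] sum.cong) auto
    then show "\<psi> (\<Sum>i\<in>I. \<epsilon> i \<omega> *\<^sub>R (X i \<omega> - m i)) = (\<Sum>J\<in>Pow I. F J \<omega> * indicator (E J) \<omega>)"
      by (simp add: sum_ind[OF \<open>\<omega> \<in> space M\<close>, of "\<lambda>J. F J \<omega>"])
  qed
  then have "(\<integral>\<omega>. \<psi> (\<Sum>i\<in>I. \<epsilon> i \<omega> *\<^sub>R (X i \<omega> - m i)) \<partial>M)
      = expectation (\<lambda>\<omega>. \<Sum>J\<in>Pow I. F J \<omega> * indicator (E J) \<omega>)"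
    using prod(1) by (intro integral_cong_AE borel_measurable_sum) auto
  also have "\<dots> = (\<Sum>J\<in>Pow I. prob (E J) * expectation (F J))"
    using prod by (subst Bochner_Integration.integral_sum) auto
  finally have average: "(\<integral>\<omega>. \<psi> (\<Sum>i\<in>I. \<epsilon> i \<omega> *\<^sub>R (X i \<omega> - m i)) \<partial>M) = \<dots>" .
  \<comment> \<open>\<open>c\<^sup>2\<close> is the mean of \<open>card (N \<omega>)\<close>. The
    tangent to the square root at this point, once averaged, returns exactly
    \<open>c\<close>.\<close>
  define c where "c = sqrt (card I / 2)"
  have c: "0 < c" "c * c = card I / 2"
    using False fin by (auto simp: c_def card_gt_0_iff)
  \<comment> \<open>AM-GM in place of Jensen's inequality for the concave square root\<close>
  have amgm: "sqrt k \<le> k / (2 * c) + c / 2" if "0 \<le> k" for k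
  proof -
    have "0 \<le> (sqrt k - c)\<^sup>2" by simp
    then have "2 * c * sqrt k \<le> k + c * c"
      using that by (simp add: power2_diff power2_eq_square algebra_simps)
    then show ?thesis using c(1) by (simp add: field_simps)
  qed
  \<comment> \<open>The weights sum to 1, so the constant \<open>a\<close> can be compared with the
    bound for each sign pattern separately.\<close>
  have "a = (\<Sum>J\<in>Pow I. prob (E J) * a)"
    by (simp add: total flip: sum_distrib_right)
  also have "\<dots> \<le> (\<Sum>J\<in>Pow I. prob (E J) * (expectation (F J) + (card J / (2 * c) + c / 2) * d))"
  proof (intro sum_mono mult_left_mono)
    fix J assume "J \<in> Pow I"
    then have "a \<le> expectation (F J) + sqrt (card J) * d"
      using bound[of J] by (simp add: F_def[abs_def])
    also have "sqrt (card J) * d \<le> (card J / (2 * c) + c / 2) * d"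
      using amgm d by (intro mult_right_mono) auto
    finally show "a \<le> expectation (F J) + (card J / (2 * c) + c / 2) * d" by simp
  qed simp
  also have "\<dots> = (\<Sum>J\<in>Pow I. prob (E J) * expectation (F J))
      + ((\<Sum>J\<in>Pow I. card J * prob (E J)) / (2 * c) + (\<Sum>J\<in>Pow I. prob (E J)) * (c / 2)) * d"
    by (simp add: sum.distrib sum_distrib_left sum_distrib_right sum_divide_distrib algebra_simps)
  also have "((\<Sum>J\<in>Pow I. card J * prob (E J)) / (2 * c) + (\<Sum>J\<in>Pow I. prob (E J)) * (c / 2)) = c"
    using c(1) by (simp only: mean_card total c(2)[symmetric]) (simp add: field_simps)
  finally show ?thesis by (simp add: average c_def)
qed

section \<open>Symmetrization with a fixed coupling\<close>

lemma integrable_distr_uminus: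
  fixes \<mu> :: "'h::{banach, second_countable_topology} measure"
  assumes "integrable \<mu> (\<lambda>x. x)" and meas: "uminus \<in> borel_measurable \<mu>"
  shows "integrable (distr \<mu> borel uminus) (\<lambda>x. x)"
proof -
  have "integrable \<mu> (\<lambda>x. - x)" using assms(1) by (rule integrable_minus)
  then show ?thesis by (subst integrable_distr_eq[OF meas]) (rule measurable_ident_sets[OF refl])
qed

lemma integral_distr_uminus:
  fixes \<mu> :: "'h::{banach, second_countable_topology} measure"
  assumes "uminus \<in> borel_measurable \<mu>"
  shows "(\<integral>x. x \<partial>distr \<mu> borel uminus) = - (\<integral>x. x \<partial>\<mu>)"
  using integral_distr[OF assms, of "\<lambda>x. x"] by simp

text \<open>Flipping the sign of a centered summand amounts to passing from the first to the second
  centered coordinate of \<open>\<gamma>\<close>. Each fixed sign pattern is handled by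
  \<open>lipschitz_sum_coupling\<close>, and \<open>rademacher_average_le\<close> averages over the
  patterns.\<close>

lemma (in prob_space) symmetrization_coupling:
  fixes X :: "'i \<Rightarrow> 'a \<Rightarrow> 'h::{real_inner, banach, second_countable_topology}"
    and \<psi> :: "'h \<Rightarrow> real"
  assumes fin: "finite I" "I \<noteq> {}"
    and indepX: "indep_vars (\<lambda>_. borel) X I"
    and law: "\<And>i. i \<in> I \<Longrightarrow> distr M borel (X i) = \<mu>"
    and X: "\<And>i. i \<in> I \<Longrightarrow> integrable M (X i)"
    and \<epsilon>: "\<And>i. i \<in> I \<Longrightarrow> rademacher M (\<epsilon> i)"
    and indep: "indep_pair M (\<Pi>\<^sub>M i\<in>I. borel) (\<lambda>\<omega>. \<lambda>i\<in>I. X i \<omega>) (\<Pi>\<^sub>M i\<in>I. borel) (\<lambda>\<omega>. \<lambda>i\<in>I. \<epsilon> i \<omega>)"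
    and \<psi>: "1-lipschitz_on UNIV \<psi>"
    and \<gamma>: "\<gamma> \<in> couplings \<mu> (distr \<mu> borel uminus)"
    and sq: "integrable \<gamma> (\<lambda>(x, y). (dist x y)\<^sup>2)"
  shows "(\<integral>\<omega>. \<psi> (\<Sum>i\<in>I. X i \<omega> - expectation (X i)) \<partial>M)
    \<le> (\<integral>\<omega>. \<psi> (\<Sum>i\<in>I. \<epsilon> i \<omega> *\<^sub>R (X i \<omega> - expectation (X i))) \<partial>M)
      + sqrt (card I / 2) * sqrt (\<integral>(x, y). (dist x y)\<^sup>2 \<partial>\<gamma>)"
proof -
  define D where "D = (\<integral>(x, y). (dist x y)\<^sup>2 \<partial>\<gamma>)"
  define m where "m = (\<integral>x. x \<partial>\<mu>)"
  have \<gamma>_prob: "prob_space \<gamma>" and sets_\<gamma>: "sets \<gamma> = sets (borel \<Otimes>\<^sub>M borel)"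
    and fst_law: "distr \<gamma> borel fst = \<mu>" and snd_law: "distr \<gamma> borel snd = distr \<mu> borel uminus"
    using \<gamma> by (auto simp: couplings_def)
  interpret \<gamma>: prob_space \<gamma> by fact
  have [measurable]: "fst \<in> borel_measurable \<gamma>" "snd \<in> borel_measurable \<gamma>"
    by (auto simp: measurable_cong_sets[OF sets_\<gamma> refl])
  have X_meas [measurable]: "X i \<in> borel_measurable M" if "i \<in> I" for i
    using X[OF that] by auto
  have sets_\<mu> [measurable_cong]: "sets \<mu> = sets borel"
    using fst_law by (metis sets_distr)
  \<comment> \<open>One index suffices to carry integrability from \<open>X j\<close> to
    \<open>\<mu>\<close>, and from there to both marginals of \<open>\<gamma>\<close>.\<close>
  obtain j where j: "j \<in> I" using fin by auto
  have mean: "expectation (X i) = m" if "i \<in> I" for i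
    using that law[OF that] by (auto simp: m_def integral_distr)
  have \<mu>_int: "integrable \<mu> (\<lambda>x. x)"
    using X[OF j] j by (simp add: integrable_distr_eq flip: law[OF j])
  have fst_int: "integrable \<gamma> fst" and fst_mean: "integral\<^sup>L \<gamma> fst = m"
    using \<mu>_int by (simp_all add: m_def integrable_distr_eq integral_distr flip: fst_law)
  have neg_meas: "uminus \<in> borel_measurable \<mu>"
    unfolding measurable_cong_sets[OF sets_\<mu> refl]
    by (intro borel_measurable_continuous_onI continuous_intros)
  have neg_int: "integrable (distr \<mu> borel uminus) (\<lambda>x. x)" and neg_mean: "(\<integral>x. x \<partial>distr \<mu> borel uminus) = - m"
    using integrable_distr_uminus[OF \<mu>_int neg_meas] integral_distr_uminus[OF neg_meas]
    unfolding m_def by blast+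
  have snd_int: "integrable \<gamma> snd" and snd_mean: "integral\<^sup>L \<gamma> snd = - m"
    using neg_int neg_mean by (simp_all add: integrable_distr_eq integral_distr flip: snd_law)
  define Z where "Z z = fst z - snd z" for z :: "'h \<times> 'h"
  \<comment> \<open>Since \<open>- (X i - m)\<close> is \<open>- X i + m\<close>, the second
    coordinate is shifted by \<open>+ m\<close>: \<open>U\<close> and \<open>V\<close> have the laws
    of \<open>X i - m\<close> and of its negative.\<close>
  define U where "U z = fst z - m" for z :: "'h \<times> 'h"
  define V where "V z = snd z + m" for z :: "'h \<times> 'h"
  have U_int: "integrable \<gamma> U" and V_int: "integrable \<gamma> V"
    unfolding U_def V_def using fst_int snd_int by auto
  note [measurable] = borel_measurable_integrable[OF U_int] borel_measurable_integrable[OF V_int]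
  have Z_int: "integrable \<gamma> Z" and Z_mean: "integral\<^sup>L \<gamma> Z = m + m"
    unfolding Z_def using fst_int snd_int by (auto simp: fst_mean snd_mean)
  have Z_dist: "(\<lambda>(x, y). (dist x y)\<^sup>2) = (\<lambda>z. (norm (Z z))\<^sup>2)"
    by (auto simp: Z_def dist_norm)
  \<comment> \<open>The coordinates have means \<open>m\<close> and \<open>- m\<close>, so the total
    shift \<open>m + m\<close> is the mean of \<open>Z\<close>. Hence \<open>U - V\<close> is
    \<open>Z\<close> centered, with second moment at most \<open>D\<close>.\<close>
  have UV: "U z - V z = Z z - integral\<^sup>L \<gamma> Z" for z
    unfolding Z_mean by (simp add: U_def V_def Z_def)
  have Z_sq: "integrable \<gamma> (\<lambda>z. (norm (Z z))\<^sup>2)" using sq by (simp add: Z_dist)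
  have D_le: "(\<integral>z. (norm (U z - V z))\<^sup>2 \<partial>\<gamma>) \<le> D"
    using \<gamma>.expectation_norm_centered_le[OF Z_int Z_sq] by (simp add: UV D_def Z_dist)
  have bound: "(\<integral>\<omega>. \<psi> (\<Sum>i\<in>I. X i \<omega> - m) \<partial>M)
      \<le> (\<integral>\<omega>. \<psi> (\<Sum>i\<in>I. (if i \<in> J then -1 else 1) *\<^sub>R (X i \<omega> - m)) \<partial>M) + sqrt (card J) * sqrt D"
    if J: "J \<subseteq> I" for J
  proof -
    have "(\<integral>\<omega>. \<psi> (\<Sum>i\<in>I. X i \<omega> - m) \<partial>M)
      \<le> (\<integral>\<omega>. \<psi> (\<Sum>i\<in>I. (if i \<in> J then -1 else 1) *\<^sub>R (X i \<omega> - m)) \<partial>M)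
        + sqrt (card J * (\<integral>z. (norm (U z - V z))\<^sup>2 \<partial>\<gamma>))"
    proof (rule lipschitz_sum_coupling[OF prob_space_axioms \<gamma>_prob fin(1) J _ _ U_int V_int _ _ _ _ \<psi>])
      show "indep_vars (\<lambda>_. borel) (\<lambda>i \<omega>. X i \<omega> - m) I"
        by (rule indep_vars_compose2[OF indepX]) simp
      show "indep_vars (\<lambda>_. borel) (\<lambda>i \<omega>. (if i \<in> J then -1 else 1) *\<^sub>R (X i \<omega> - m)) I"
        by (rule indep_vars_compose2[OF indepX]) simp
      show "(\<integral>z. U z - V z \<partial>\<gamma>) = 0"
        using Z_int by (simp add: UV \<gamma>.prob_space)
      show "integrable \<gamma> (\<lambda>z. (norm (U z - V z))\<^sup>2)"
        using \<gamma>.integrable_norm_centered[OF Z_int Z_sq] by (simp add: UV)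
      have fst_X: "distr M borel (X i) = distr \<gamma> borel fst" if "i \<in> I" for i
        using law[OF that] fst_law by simp
      show U_law: "distr M borel (\<lambda>\<omega>. X i \<omega> - m) = distr \<gamma> borel U" if "i \<in> I" for i
        unfolding U_def using that by (intro distr_eq_imp_distr_comp_eq[OF fst_X]) auto
      have neg_X: "distr M borel (\<lambda>\<omega>. - X i \<omega>) = distr \<gamma> borel snd" if "i \<in> I" for i
        unfolding snd_law using that by (subst law[OF that, symmetric]) (simp add: distr_distr comp_def)
      have V_law: "distr M borel (\<lambda>\<omega>. - X i \<omega> + m) = distr \<gamma> borel V" if "i \<in> I" for i
        unfolding V_def using that by (intro distr_eq_imp_distr_comp_eq[OF neg_X]) auto
      show "distr M borel (\<lambda>\<omega>. (if i \<in> J then -1 else 1) *\<^sub>R (X i \<omega> - m))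
          = distr \<gamma> borel (if i \<in> J then V else U)" if "i \<in> I" for i
        using U_law[OF that] V_law[OF that] by auto
    qed
    also have "sqrt (card J * (\<integral>z. (norm (U z - V z))\<^sup>2 \<partial>\<gamma>)) \<le> sqrt (card J) * sqrt D"
      using D_le by (simp add: mult_left_mono flip: real_sqrt_mult)
    finally show ?thesis by simp
  qed
  have "0 \<le> sqrt D"
    by (auto simp: D_def intro!: real_sqrt_ge_zero integral_nonneg_AE)
  from rademacher_average_le[OF fin(1) indep X \<epsilon> \<psi> this bound]
  show ?thesis by (simp add: mean D_def cong: sum.cong)
qed

section \<open>Passing to the infimum over couplings\<close>

theorem lemma2p5:
  fixes M :: "'w measure"
    and n :: nat
    and X :: "nat \<Rightarrow> 'w \<Rightarrow> 'h::{real_inner, banach, second_countable_topology}"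
    and \<epsilon> :: "nat \<Rightarrow> 'w \<Rightarrow> real"
    and \<mu> :: "'h measure"
    and \<psi> :: "'h \<Rightarrow> real"
  assumes "prob_space M"
    and "prob_space.indep_vars M (\<lambda>_. borel) X {1..n}"
    and "\<And>i. i \<in> {1..n} \<Longrightarrow> distr M borel (X i) = \<mu>"
    and "\<And>i. i \<in> {1..n} \<Longrightarrow> integrable M (X i)"
    and "prob_space.indep_vars M (\<lambda>_. borel) \<epsilon> {1..n}"
    and "\<And>i. i \<in> {1..n} \<Longrightarrow> rademacher M (\<epsilon> i)"
    and "indep_pair M
           (\<Pi>\<^sub>M i\<in>{1..n}. borel) (\<lambda>\<omega>. \<lambda>i\<in>{1..n}. X i \<omega>)
           (\<Pi>\<^sub>M i\<in>{1..n}. borel) (\<lambda>\<omega>. \<lambda>i\<in>{1..n}. \<epsilon> i \<omega>)"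
    and "1-lipschitz_on UNIV \<psi>"
  shows "ereal (\<integral>\<omega>. \<psi> (\<Sum>i=1..n. X i \<omega> - (\<integral>\<omega>'. X i \<omega>' \<partial>M)) \<partial>M)
       \<le> ereal (\<integral>\<omega>. \<psi> (\<Sum>i=1..n. \<epsilon> i \<omega> *\<^sub>R (X i \<omega> - (\<integral>\<omega>'. X i \<omega>' \<partial>M))) \<partial>M)
         + ereal (sqrt (real n / 2)) * enn2ereal (wasserstein 2 \<mu> (distr \<mu> borel uminus))"
\<comment> \<open>For \<open>n = 0\<close> both sums are empty and the factor is 0; in
  \<open>ereal\<close> its product with the Wasserstein term is 0 even if that term is infinite.
  Otherwise \<open>c\<close> below is positive and can be divided by.\<close>
proof (cases "n = 0")
  case True
  interpret prob_space M by fact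
  show ?thesis using True by (simp add: prob_space flip: zero_ereal_def)
next
  case False
  interpret prob_space M by fact
  let ?W = "wasserstein 2 \<mu> (distr \<mu> borel uminus)"
  define a where "a = (\<integral>\<omega>. \<psi> (\<Sum>i=1..n. X i \<omega> - (\<integral>\<omega>'. X i \<omega>' \<partial>M)) \<partial>M)"
  define b where "b = (\<integral>\<omega>. \<psi> (\<Sum>i=1..n. \<epsilon> i \<omega> *\<^sub>R (X i \<omega> - (\<integral>\<omega>'. X i \<omega>' \<partial>M))) \<partial>M)"
  define c where "c = sqrt (real n / 2)"
  have c: "0 < c" using False by (simp add: c_def)
  \<comment> \<open>Solved for the distance, the claim is a lower bound on an infimum, so it can be
    checked on each coupling.\<close>
  have "ennreal ((a - b) / c) \<le> ?W"
    unfolding wasserstein_def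
  proof (rule INF_greatest)
    fix \<gamma> assume \<gamma>: "\<gamma> \<in> couplings \<mu> (distr \<mu> borel uminus)"
    have \<gamma>_sets: "sets \<gamma> = sets (borel \<Otimes>\<^sub>M borel)" using \<gamma> by (simp add: couplings_def)
    let ?C = "\<integral>\<^sup>+ (x, y). ennreal (dist x y powr 2) \<partial>\<gamma>"
    have C_eq: "?C = (\<integral>\<^sup>+ z. ennreal (case z of (x, y) \<Rightarrow> (dist x y)\<^sup>2) \<partial>\<gamma>)"
      by (intro nn_integral_cong) auto
    show "ennreal ((a - b) / c) \<le> ennreal_root 2 ?C"
    \<comment> \<open>An infinite cost makes the bound trivial; a finite one supplies the square
      integrability that \<open>symmetrization_coupling\<close> requires.\<close>
    proof (cases "?C = \<top>")
      case True
      then show ?thesis by (simp add: ennreal_root_def)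
    next
      case fin: False
      have "(\<lambda>(x, y). (dist x y)\<^sup>2) \<in> borel_measurable \<gamma>"
        unfolding measurable_cong_sets[OF \<gamma>_sets refl] by measurable
      moreover have "(\<integral>\<^sup>+ z. ennreal (case z of (x, y) \<Rightarrow> (dist x y)\<^sup>2) \<partial>\<gamma>) < \<top>"
        using fin unfolding C_eq by (simp only: top.not_eq_extremum)
      ultimately have sq: "integrable \<gamma> (\<lambda>(x, y). (dist x y)\<^sup>2)"
        by (intro integrableI_nonneg) auto
      have D: "(\<integral>(x, y). (dist x y)\<^sup>2 \<partial>\<gamma>) = enn2real ?C"
        unfolding C_eq using sq by (intro integral_eq_nn_integral) auto
      have "a \<le> b + sqrt (card {1..n} / 2) * sqrt (\<integral>(x, y). (dist x y)\<^sup>2 \<partial>\<gamma>)"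
        unfolding a_def b_def
        by (rule symmetrization_coupling[OF _ _ assms(2-4,6-8) \<gamma> sq]) (use False in auto)
      then have "(a - b) / c \<le> sqrt (enn2real ?C)"
        using c by (simp add: D c_def[symmetric] field_simps)
      then show ?thesis
        using fin by (simp add: ennreal_root_def powr_half_sqrt ennreal_leI)
    qed
  qed
  \<comment> \<open>\<open>ennreal\<close> truncates a negative quotient to 0; in that case
    nonnegativity of the distance gives the inequality.\<close>
  then have "ereal ((a - b) / c) \<le> enn2ereal ?W"
    by (cases "0 \<le> (a - b) / c")
      (auto simp: less_eq_ennreal.rep_eq intro: order_trans[OF _ enn2ereal_nonneg])
  then have "ereal c * ereal ((a - b) / c) \<le> ereal c * enn2ereal ?W"
    using c by (intro ereal_mult_left_mono) auto
  then have "ereal (a - b) \<le> ereal c * enn2ereal ?W"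
    using c by simp
  then have "ereal b + ereal (a - b) \<le> ereal b + ereal c * enn2ereal ?W"
    by (rule add_left_mono)
  then show ?thesis by (simp add: a_def b_def c_def)
qed

end
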